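(* Assume that for every $1\le h\le H$ the distribution $P_h$ of $(s_h,a_h)$ is absolutely continuous with respect to $\mu$, with Radon--Nikodym derivative $w_h=\frac{dP_h}{d\mu}$. Let $\mathcal F$ be a dense Banach subspace of $L^1(\mu)$. Then there exists a link function $\varphi_{\mathcal F}:\mathbb R_{\ge 0}\to\mathbb R_{\ge 0}$ such that $$\varphi_{\mathcal F}(y)\le C\max_{1\le h\le H}\|w_h\|_{\mathcal F}\; y\qquad\text{for all } y\ge 0,$$ and $$|\Delta J(Q^X)|\le \varphi_{\mathcal F}\Big(\frac1C\sum_{h=1}^H\gamma^{H-h}\,\|\Delta X\,Q^X_{h-1}\|_{\mathcal F^*}\Big)\qquad\text{for all } X\in\Omega.$$
   Context: All functions (and images of functions under operators) are assumed suitably measurable. $\mathcal P(\cdot)$ denotes the set of probability distributions on a space. The state-action space $\mathcal S\times\mathcal A$ is a compact measurable space. A Markov decision process consists of an initial state distribution $S_1\in\mathcal P(\mathcal S)$, reward distributions $R(s,a)\in\mathcal P([0,1])$ and transition distributions $T(s,a)\in\mathcal P(\mathcal S)$. A policy is a map $s\mapsto\pi(s)\in\mathcal P(\mathcal A)$. Fix a horizon $1\le H<\infty$ and a discount factor $\gamma\in[0,1]$, and put $C=\sum_{h=1}^H\gamma^{h-1}$. Trajectories are generated by $s_1\sim S_1$, $a_h\sim\pi(s_h)$, $r_h\sim R(s_h,a_h)$, $s_{h+1}\sim T(s_h,a_h)$, $h\ge1$; $P_h$ is the distribution of $(s_h,a_h)$. $\mu\in\mathcal P(\mathcal S\times\mathcal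 A)$ is a distribution with $\mathrm{supp}(\mu)=\mathcal S\times\mathcal A$, and $\|\cdot\|_p$ is the $L^p(\mu)$-norm. For $f:\mathcal S\times\mathcal A\to\mathbb R$ write $f(s,\pi(s))=\mathbb E_{a\sim\pi(s)}[f(s,a)]$. The Bellman operator is $(B_\pi f)(s,a)=\mathbb E[r+\gamma f(s',\pi(s'))]$ with $r\sim R(s,a)$, $s'\sim T(s,a)$. The action-value function is $Q^\pi(s,a)=\mathbb E[\sum_{h=1}^H\gamma^{h-1}r_h\mid s_1=s,a_1=a]=(B_\pi^H 0)(s,a)$. For a function $Q$, $J(Q)=\mathbb E[Q(s_1,\pi(s_1))]$ with $s_1\sim S_1$, and $\Delta J(Q)=J(Q)-J(Q^\pi)$. $\Omega$ is the set of all operators $X:[0,C]^{\mathcal S\times\mathcal A}\to[0,C]^{\mathcal S\times\mathcal A}$. For $X\in\Omega$: $Q^X_0=0$, $Q^X_h=XQ^X_{h-1}$, $Q^X=Q^X_H$, and $\Delta X=X-B_\pi$, i.e. $(\Delta X)f=Xf-B_\pi f$ for $f:\mathcal S\times\mathcal A\to[0,C]$. A Banach subspace $\mathcal F$ of $L^1(\mu)$ is a linear subspace of $L^1(\mu)$ that is a Banach space under its own norm $\|\cdot\|_{\mathcal F}$, continuously included in $L^1(\mu)$; we set $\|g\|_{\mathcal F}=+\infty$ for $g\notin\mathcal F$ (an upper bound involving an infinite norm is regarded as vacuous). Dense means dense in $L^1(\mu)$ with respect to $\|\cdot\|_1$. The dual norm of a function $g$ is $\|g\|_{\mathcal F^*}=\sup_{\|f\|_{\mathcal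 F}\le1}\mathbb E_{(s,a)\sim\mu}[f(s,a)g(s,a)]$. A link function is a function $\varphi:\mathbb R_{\ge0}\to\mathbb R$ that is nonnegative, nondecreasing, continuous, concave and satisfies $\varphi(0)=0$. *)

theory Defs
  imports "HOL-Probability.Probability"
begin


record ('s, 'a) mdp =
  state_topology :: "'s topology"
  action_topology :: "'a topology"
  state_space :: "'s measure"
  action_space :: "'a measure"
  init :: "'s measure"
  reward :: "'s \<times> 'a \<Rightarrow> real measure"
  transition :: "'s \<times> 'a \<Rightarrow> 's measure"

text \<open>The measures \<open>state_space M\<close> and \<open>action_space M\<close> serve only as measurable spaces
  (carrier and sigma-algebra).\<close>

definition sa_space :: "('s, 'a) mdp \<Rightarrow> ('s \<times> 'a) measure" where
  "sa_space M = state_space M \<Otimes>\<^sub>M action_space M"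

definition sa_topology :: "('s, 'a) mdp \<Rightarrow> ('s \<times> 'a) topology" where
  "sa_topology M = prod_topology (state_topology M) (action_topology M)"

abbreviation reward_space :: "real measure" where
  "reward_space \<equiv> restrict_space borel {0..1}"

definition is_mdp :: "('s, 'a) mdp \<Rightarrow> bool" where
  "is_mdp M \<longleftrightarrow>
     topspace (state_topology M) = space (state_space M) \<and>
     (\<forall>U. openin (state_topology M) U \<longrightarrow> U \<in> sets (state_space M)) \<and>
     topspace (action_topology M) = space (action_space M) \<and>
     (\<forall>U. openin (action_topology M) U \<longrightarrow> U \<in> sets (action_space M)) \<and>
     compact_space (sa_topology M) \<and>
     init M \<in> space (prob_algebra (state_space M)) \<and>
     reward M \<in> sa_space M \<rightarrow>\<^sub>M prob_algebra reward_space \<and>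
     transition M \<in> sa_space M \<rightarrow>\<^sub>M prob_algebra (state_space M)"

definition is_policy :: "('s, 'a) mdp \<Rightarrow> ('s \<Rightarrow> 'a measure) \<Rightarrow> bool" where
  "is_policy M \<pi> \<longleftrightarrow> \<pi> \<in> state_space M \<rightarrow>\<^sub>M prob_algebra (action_space M)"

text \<open>Only measurable open neighbourhoods are tested, because the product sigma-algebra need not
  contain every open set of the product topology. The measurable open rectangles form a basis of
  that topology, so this is the usual topological support.\<close>

definition measure_support :: "'x topology \<Rightarrow> 'x measure \<Rightarrow> 'x set" where
  "measure_support X \<mu> =
     {x \<in> topspace X. \<forall>U \<in> sets \<mu>. openin X U \<and> x \<in> U \<longrightarrow> emeasure \<mu> U > 0}"

text \<open>Joint law of \<open>(s, a)\<close> with \<open>s\<close> drawn from \<open>\<rho>\<close> and \<open>a\<close> drawn from \<open>\<pi> s\<close>.\<close>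

definition act :: "('s, 'a) mdp \<Rightarrow> ('s \<Rightarrow> 'a measure) \<Rightarrow> 's measure \<Rightarrow> ('s \<times> 'a) measure" where
  "act M \<pi> \<rho> = \<rho> \<bind> (\<lambda>s. \<pi> s \<bind> (\<lambda>a. return (sa_space M) (s, a)))"

definition traj_space :: "('s, 'a) mdp \<Rightarrow> nat \<Rightarrow> (nat \<Rightarrow> ('s \<times> 'a) \<times> real) measure" where
  "traj_space M n = PiM {1..n} (\<lambda>_. sa_space M \<Otimes>\<^sub>M reward_space)"

text \<open>\<open>trajectory M \<pi> \<nu> n\<close> is the joint law of \<open>((s\<^sub>h, a\<^sub>h), r\<^sub>h)\<close>, \<open>1 \<le> h \<le> n\<close>, when
  \<open>(s\<^sub>1, a\<^sub>1)\<close> has law \<open>\<nu>\<close> and the process then evolves under the policy \<open>\<pi>\<close>.\<close>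

primrec trajectory ::
  "('s, 'a) mdp \<Rightarrow> ('s \<Rightarrow> 'a measure) \<Rightarrow> ('s \<times> 'a) measure \<Rightarrow> nat \<Rightarrow>
   (nat \<Rightarrow> ('s \<times> 'a) \<times> real) measure" where
  "trajectory M \<pi> \<nu> 0 = return (traj_space M 0) (\<lambda>_. undefined)"
| "trajectory M \<pi> \<nu> (Suc n) =
     trajectory M \<pi> \<nu> n \<bind> (\<lambda>\<omega>.
       (if n = 0 then \<nu> else act M \<pi> (transition M (fst (\<omega> n)))) \<bind> (\<lambda>x.
         reward M x \<bind> (\<lambda>r. return (traj_space M (Suc n)) (fun_upd \<omega> (Suc n) (x, r)))))"

definition sa_dist :: "('s, 'a) mdp \<Rightarrow> ('s \<Rightarrow> 'a measure) \<Rightarrow> nat \<Rightarrow> ('s \<times> 'a) measure" where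
  "sa_dist M \<pi> h = distr (trajectory M \<pi> (act M \<pi> (init M)) h) (sa_space M) (\<lambda>\<omega>. fst (\<omega> h))"

definition horizon_const :: "nat \<Rightarrow> real \<Rightarrow> real" where
  "horizon_const H \<gamma> = (\<Sum>h = 1..H. \<gamma> ^ (h - 1))"

definition policy_value :: "('s \<Rightarrow> 'a measure) \<Rightarrow> ('s \<times> 'a \<Rightarrow> real) \<Rightarrow> 's \<Rightarrow> real" where
  "policy_value \<pi> f s = (LINT a | \<pi> s. f (s, a))"

definition bellman ::
  "('s, 'a) mdp \<Rightarrow> ('s \<Rightarrow> 'a measure) \<Rightarrow> real \<Rightarrow> ('s \<times> 'a \<Rightarrow> real) \<Rightarrow> 's \<times> 'a \<Rightarrow> real" where
  "bellman M \<pi> \<gamma> f x =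
     (LINT r | reward M x. LINT s' | transition M x. r + \<gamma> * policy_value \<pi> f s')"

text \<open>Conditioning on \<open>s\<^sub>1 = s\<close>, \<open>a\<^sub>1 = a\<close> means starting the trajectory at \<open>x = (s, a)\<close>.\<close>

definition action_value ::
  "('s, 'a) mdp \<Rightarrow> ('s \<Rightarrow> 'a measure) \<Rightarrow> nat \<Rightarrow> real \<Rightarrow> 's \<times> 'a \<Rightarrow> real" where
  "action_value M \<pi> H \<gamma> x =
     (LINT \<omega> | trajectory M \<pi> (return (sa_space M) x) H. (\<Sum>h = 1..H. \<gamma> ^ (h - 1) * snd (\<omega> h)))"

definition J :: "('s, 'a) mdp \<Rightarrow> ('s \<Rightarrow> 'a measure) \<Rightarrow> ('s \<times> 'a \<Rightarrow> real) \<Rightarrow> real" where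
  "J M \<pi> Q = (LINT s | init M. policy_value \<pi> Q s)"

definition \<Delta>J ::
  "('s, 'a) mdp \<Rightarrow> ('s \<Rightarrow> 'a measure) \<Rightarrow> nat \<Rightarrow> real \<Rightarrow> ('s \<times> 'a \<Rightarrow> real) \<Rightarrow> real" where
  "\<Delta>J M \<pi> H \<gamma> Q = J M \<pi> Q - J M \<pi> (action_value M \<pi> H \<gamma>)"

definition value_functions :: "('s, 'a) mdp \<Rightarrow> real \<Rightarrow> ('s \<times> 'a \<Rightarrow> real) set" where
  "value_functions M c =
     {f \<in> borel_measurable (sa_space M). \<forall>x \<in> space (sa_space M). 0 \<le> f x \<and> f x \<le> c}"

definition operators ::
  "('s, 'a) mdp \<Rightarrow> real \<Rightarrow> (('s \<times> 'a \<Rightarrow> real) \<Rightarrow> 's \<times> 'a \<Rightarrow> real) set" where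
  "operators M c = value_functions M c \<rightarrow> value_functions M c"

definition Q_iter :: "(('x \<Rightarrow> real) \<Rightarrow> 'x \<Rightarrow> real) \<Rightarrow> nat \<Rightarrow> 'x \<Rightarrow> real" where
  "Q_iter X h = (X ^^ h) (\<lambda>_. 0)"

definition \<Delta>op ::
  "('s, 'a) mdp \<Rightarrow> ('s \<Rightarrow> 'a measure) \<Rightarrow> real \<Rightarrow> (('s \<times> 'a \<Rightarrow> real) \<Rightarrow> 's \<times> 'a \<Rightarrow> real) \<Rightarrow>
   ('s \<times> 'a \<Rightarrow> real) \<Rightarrow> 's \<times> 'a \<Rightarrow> real" where
  "\<Delta>op M \<pi> \<gamma> X f = (\<lambda>x. X f x - bellman M \<pi> \<gamma> f x)"

definition norm_L1 :: "'x measure \<Rightarrow> ('x \<Rightarrow> real) \<Rightarrow> real" where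
  "norm_L1 \<mu> f = (LINT x | \<mu>. \<bar>f x\<bar>)"

text \<open>Elements of \<open>L\<^sup>1(\<mu>)\<close> are represented by integrable functions. A subspace of \<open>L\<^sup>1(\<mu>)\<close> is
  therefore a set \<open>F\<close> of integrable functions that is closed under almost everywhere equality,
  and its norm \<open>N\<close> is constant on the almost everywhere classes and vanishes exactly on the
  class of \<open>0\<close>.\<close>

definition banach_subspace_L1 :: "'x measure \<Rightarrow> ('x \<Rightarrow> real) set \<Rightarrow> (('x \<Rightarrow> real) \<Rightarrow> real) \<Rightarrow> bool" where
  "banach_subspace_L1 \<mu> F N \<longleftrightarrow>
     F \<subseteq> {f. integrable \<mu> f} \<and>
     (\<forall>f \<in> F. \<forall>g \<in> borel_measurable \<mu>. (AE x in \<mu>. f x = g x) \<longrightarrow> g \<in> F \<and> N g = N f) \<and>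
     (\<lambda>_. 0) \<in> F \<and>
     (\<forall>f \<in> F. \<forall>g \<in> F. (\<lambda>x. f x + g x) \<in> F \<and> N (\<lambda>x. f x + g x) \<le> N f + N g) \<and>
     (\<forall>c. \<forall>f \<in> F. (\<lambda>x. c * f x) \<in> F \<and> N (\<lambda>x. c * f x) = \<bar>c\<bar> * N f) \<and>
     (\<forall>f \<in> F. 0 \<le> N f \<and> (N f = 0 \<longleftrightarrow> (AE x in \<mu>. f x = 0))) \<and>
     (\<forall>u. (\<forall>n::nat. u n \<in> F) \<and>
          (\<forall>e>0. \<exists>n0. \<forall>m\<ge>n0. \<forall>n\<ge>n0. N (\<lambda>x. u m x - u n x) < e) \<longrightarrow>
          (\<exists>f \<in> F. (\<lambda>n. N (\<lambda>x. u n x - f x)) \<longlonglongrightarrow> 0)) \<and>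
     (\<exists>K. \<forall>f \<in> F. norm_L1 \<mu> f \<le> K * N f)"

definition dense_in_L1 :: "'x measure \<Rightarrow> ('x \<Rightarrow> real) set \<Rightarrow> bool" where
  "dense_in_L1 \<mu> F \<longleftrightarrow>
     (\<forall>g. integrable \<mu> g \<longrightarrow> (\<forall>e>0. \<exists>f \<in> F. norm_L1 \<mu> (\<lambda>x. g x - f x) < e))"

definition ext_norm :: "('x \<Rightarrow> real) set \<Rightarrow> (('x \<Rightarrow> real) \<Rightarrow> real) \<Rightarrow> ('x \<Rightarrow> real) \<Rightarrow> ereal" where
  "ext_norm F N g = (if g \<in> F then ereal (N g) else \<infinity>)"

text \<open>This real supremum is meaningful for bounded measurable \<open>g\<close>, the only functions to which
  it is applied; see \<open>dual_norm_bdd\<close>.\<close>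

definition dual_norm ::
  "'x measure \<Rightarrow> ('x \<Rightarrow> real) set \<Rightarrow> (('x \<Rightarrow> real) \<Rightarrow> real) \<Rightarrow> ('x \<Rightarrow> real) \<Rightarrow> real" where
  "dual_norm \<mu> F N g = (SUP f \<in> {f \<in> F. N f \<le> 1}. LINT x | \<mu>. f x * g x)"

lemma dual_norm_bdd:
  assumes F: "banach_subspace_L1 \<mu> F N"
    and g: "g \<in> borel_measurable \<mu>" "\<And>x. x \<in> space \<mu> \<Longrightarrow> \<bar>g x\<bar> \<le> B"
  shows "bdd_above ((\<lambda>f. LINT x | \<mu>. f x * g x) ` {f \<in> F. N f \<le> 1})"
proof -
  obtain K where K: "\<And>f. f \<in> F \<Longrightarrow> norm_L1 \<mu> f \<le> K * N f"
    using F unfolding banach_subspace_L1_def by blast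
  have "(LINT x | \<mu>. f x * g x) \<le> \<bar>B\<bar> * \<bar>K\<bar>" if f: "f \<in> F" "N f \<le> 1" for f
  proof -
    have int: "integrable \<mu> f" and N: "0 \<le> N f"
      using F f unfolding banach_subspace_L1_def by blast+
    have le: "f x * g x \<le> \<bar>B\<bar> * \<bar>f x\<bar>" "\<bar>f x * g x\<bar> \<le> \<bar>\<bar>B\<bar> * f x\<bar>" if "x \<in> space \<mu>" for x
    proof -
      have "\<bar>f x\<bar> * \<bar>g x\<bar> \<le> \<bar>f x\<bar> * \<bar>B\<bar>"
        using g(2)[OF that] by (intro mult_left_mono) auto
      then show "f x * g x \<le> \<bar>B\<bar> * \<bar>f x\<bar>" "\<bar>f x * g x\<bar> \<le> \<bar>\<bar>B\<bar> * f x\<bar>"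
        by (simp_all add: abs_mult mult.commute) (metis abs_ge_self abs_mult mult.commute order_trans)
    qed
    have "integrable \<mu> (\<lambda>x. f x * g x)"
      by (rule Bochner_Integration.integrable_bound[of \<mu> "\<lambda>x. \<bar>B\<bar> * f x"])
        (use int g le in \<open>auto intro!: AE_I2\<close>)
    then have "(LINT x | \<mu>. f x * g x) \<le> (LINT x | \<mu>. \<bar>B\<bar> * \<bar>f x\<bar>)"
      using int le by (intro integral_mono) auto
    also have "\<dots> = \<bar>B\<bar> * norm_L1 \<mu> f"
      by (simp add: norm_L1_def)
    also have "norm_L1 \<mu> f \<le> \<bar>K\<bar>"
    proof -
      have "K * N f \<le> \<bar>K\<bar> * N f"
        using N by (intro mult_right_mono) auto
      also have "\<dots> \<le> \<bar>K\<bar> * 1"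
        using f by (intro mult_left_mono) auto
      finally show ?thesis using K[OF f(1)] by simp
    qed
    finally show ?thesis by (simp add: mult_left_mono)
  qed
  then show ?thesis by (auto intro!: bdd_aboveI2)
qed

definition link_function :: "(real \<Rightarrow> real) \<Rightarrow> bool" where
  "link_function \<phi> \<longleftrightarrow>
     (\<forall>y\<ge>0. 0 \<le> \<phi> y) \<and> mono_on {0..} \<phi> \<and> continuous_on {0..} \<phi> \<and> concave_on {0..} \<phi> \<and> \<phi> 0 = 0"

definition density_ratio :: "'x measure \<Rightarrow> 'x measure \<Rightarrow> 'x \<Rightarrow> real" where
  "density_ratio \<mu> P x = enn2real (RN_deriv \<mu> P x)"

end

theory Submission
  imports Defs
begin

text \<open>Writing \<open>Q\<^sub>h = B\<^sub>\<pi> Q\<^sub>h\<^sub>-\<^sub>1 + g\<^sub>h\<close> with \<open>g\<^sub>h = \<Delta>X Q\<^sub>h\<^sub>-\<^sub>1\<close> and iterating, the errors \<open>g\<^sub>h\<close> are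
  transported along the trajectory and the value error becomes
  \<open>\<Sum>h. \<gamma> ^ (H - h) * E[g\<^sub>h]\<close>, the expectation being with respect to \<open>P\<close> at time \<open>H - h + 1\<close>, that is
  the \<open>\<mu>\<close>-integral of \<open>w * g\<^sub>h\<close>. For \<open>f \<in> F\<close> and \<open>\<bar>g\<bar> \<le> b\<close> one has
  \<open>\<bar>\<integral> w g\<bar> \<le> b \<parallel>w - f\<parallel>\<^sub>1 + \<parallel>f\<parallel>\<^sub>F \<parallel>g\<parallel>\<^sub>F\<^sub>*\<close>. The link function is the infimum of the resulting
  affine bounds over all tuples \<open>f\<close> of elements of \<open>F\<close> (a K-functional): an infimum of nonnegative,
  nondecreasing affine functions is concave, density of \<open>F\<close> makes it vanish and be continuous at
  \<open>0\<close>, and the choice \<open>f = w\<close> gives the linear bound.\<close>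

subsection \<open>Integrals of bounded functions against probability kernels\<close>

text \<open>Such functions are integrable for every probability measure and stable under probability
  kernels, so each Fubini step below is unconditional. The bound is required on
  \<open>space S\<close> only, since nothing controls functions off the carrier.\<close>

definition bounded_measurable :: "'x measure \<Rightarrow> ('x \<Rightarrow> real) set" where
  "bounded_measurable S = {f \<in> borel_measurable S. \<exists>B. \<forall>x \<in> space S. \<bar>f x\<bar> \<le> B}"

lemma bounded_measurableI:
  "f \<in> borel_measurable S \<Longrightarrow> (\<And>x. x \<in> space S \<Longrightarrow> \<bar>f x\<bar> \<le> B) \<Longrightarrow> f \<in> bounded_measurable S"
  unfolding bounded_measurable_def by blast

lemma bounded_measurableD: "f \<in> bounded_measurable S \<Longrightarrow> f \<in> borel_measurable S"
  unfolding bounded_measurable_def by blast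

lemma bounded_measurable_const: "(\<lambda>_. c) \<in> bounded_measurable S"
  by (rule bounded_measurableI[where B = "\<bar>c\<bar>"]) auto

lemma bounded_measurable_add:
  assumes "f \<in> bounded_measurable S" "g \<in> bounded_measurable S"
  shows "(\<lambda>x. f x + g x) \<in> bounded_measurable S"
proof -
  obtain A B where AB: "\<And>x. x \<in> space S \<Longrightarrow> \<bar>f x\<bar> \<le> A" "\<And>x. x \<in> space S \<Longrightarrow> \<bar>g x\<bar> \<le> B"
    using assms unfolding bounded_measurable_def by blast
  have "\<bar>f x + g x\<bar> \<le> A + B" if "x \<in> space S" for x
    using AB[OF that] by linarith
  then show ?thesis
    using assms[THEN bounded_measurableD] by (intro bounded_measurableI[where B = "A + B"]) auto
qed

lemma bounded_measurable_mult:
  assumes "f \<in> bounded_measurable S" "g \<in> bounded_measurable S"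
  shows "(\<lambda>x. f x * g x) \<in> bounded_measurable S"
proof -
  obtain A B where AB: "\<And>x. x \<in> space S \<Longrightarrow> \<bar>f x\<bar> \<le> A" "\<And>x. x \<in> space S \<Longrightarrow> \<bar>g x\<bar> \<le> B"
    using assms unfolding bounded_measurable_def by blast
  have "\<bar>f x * g x\<bar> \<le> A * B" if "x \<in> space S" for x
    using AB[OF that] unfolding abs_mult by (intro mult_mono) auto
  then show ?thesis
    using assms[THEN bounded_measurableD] by (intro bounded_measurableI[where B = "A * B"]) auto
qed

lemma bounded_measurable_cmult: "f \<in> bounded_measurable S \<Longrightarrow> (\<lambda>x. c * f x) \<in> bounded_measurable S"
  by (rule bounded_measurable_mult[OF bounded_measurable_const])

lemma bounded_measurable_diff:
  assumes "f \<in> bounded_measurable S" "g \<in> bounded_measurable S"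
  shows "(\<lambda>x. f x - g x) \<in> bounded_measurable S"
  using bounded_measurable_add[OF assms(1) bounded_measurable_cmult[OF assms(2), of "-1"]] by simp

lemma bounded_measurable_compose:
  assumes "g \<in> bounded_measurable T" "f \<in> S \<rightarrow>\<^sub>M T"
  shows "(\<lambda>x. g (f x)) \<in> bounded_measurable S"
proof -
  obtain B where "\<And>x. x \<in> space T \<Longrightarrow> \<bar>g x\<bar> \<le> B"
    using assms unfolding bounded_measurable_def by blast
  then show ?thesis
    using measurable_space[OF assms(2)]
    by (intro bounded_measurableI[OF measurable_compose[OF assms(2) bounded_measurableD[OF assms(1)]], where B = B])
      auto
qed

lemma space_prob_algebraD:
  assumes "P \<in> space (prob_algebra S)"
  shows "prob_space P" "sets P = sets S" "space P = space S"
  using assms sets_eq_imp_space_eq[of P S] by (auto simp: space_prob_algebra)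

lemma bounded_measurable_integrable:
  assumes P: "P \<in> space (prob_algebra S)" and f: "f \<in> bounded_measurable S"
  shows "integrable P f"
proof -
  interpret prob_space P by (rule space_prob_algebraD[OF P])
  obtain B where "\<And>x. x \<in> space S \<Longrightarrow> \<bar>f x\<bar> \<le> B"
    using f unfolding bounded_measurable_def by blast
  then show ?thesis
    using f[THEN bounded_measurableD] space_prob_algebraD[OF P]
    by (intro integrable_const_bound[where B = B]) (auto cong: measurable_cong_sets)
qed

lemma abs_integral_le_bound:
  fixes f :: "'x \<Rightarrow> real"
  assumes P: "P \<in> space (prob_algebra S)" and B: "\<And>x. x \<in> space S \<Longrightarrow> \<bar>f x\<bar> \<le> B"
    and f: "f \<in> borel_measurable S"
  shows "\<bar>LINT x | P. f x\<bar> \<le> B"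
proof -
  interpret prob_space P by (rule space_prob_algebraD[OF P])
  have int: "integrable P f"
    using bounded_measurable_integrable[OF P] bounded_measurableI[of f S B] f B by blast
  have "\<bar>LINT x | P. f x\<bar> \<le> (LINT x | P. \<bar>f x\<bar>)"
    by (rule integral_abs_bound)
  also have "\<dots> \<le> (LINT x | P. B)"
    using int B space_prob_algebraD[OF P] by (intro integral_mono) auto
  finally show ?thesis by (simp add: prob_space)
qed

lemma bounded_measurable_kernel_integral:
  assumes K: "K \<in> S \<rightarrow>\<^sub>M prob_algebra T" and f: "f \<in> bounded_measurable T"
  shows "(\<lambda>x. LINT y | K x. f y) \<in> bounded_measurable S"
proof -
  obtain B where B: "\<And>x. x \<in> space T \<Longrightarrow> \<bar>f x\<bar> \<le> B"
    using f unfolding bounded_measurable_def by blast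
  show ?thesis
  proof (rule bounded_measurableI)
    show "(\<lambda>x. LINT y | K x. f y) \<in> borel_measurable S"
      using f[THEN bounded_measurableD] measurable_prob_algebraD[OF K]
      by (rule measurable_compose[OF _ integral_measurable_subprob_algebra, rotated])
    show "\<bar>LINT y | K x. f y\<bar> \<le> B" if "x \<in> space S" for x
      using measurable_space[OF K that] f[THEN bounded_measurableD] B by (intro abs_integral_le_bound[where S = T])
  qed
qed

lemma bounded_measurable_cong:
  assumes g: "g \<in> bounded_measurable S" and eq: "\<And>x. x \<in> space S \<Longrightarrow> f x = g x"
  shows "f \<in> bounded_measurable S"
proof -
  obtain B where "\<And>x. x \<in> space S \<Longrightarrow> \<bar>g x\<bar> \<le> B"
    using g unfolding bounded_measurable_def by blast
  moreover have "f \<in> borel_measurable S"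
    using measurable_cong[of S f g borel, OF eq] bounded_measurableD[OF g] by simp
  ultimately show ?thesis
    using eq by (intro bounded_measurableI[where B = B]) auto
qed

text \<open>Pushing \<open>K x\<close> forward along \<open>Pair x\<close> moves the parameter from
  the integrand into the kernel, which reduces the claim to the parameter-free case.\<close>

lemma bounded_measurable_parametric_integral:
  assumes K: "K \<in> S \<rightarrow>\<^sub>M prob_algebra T" and f: "f \<in> bounded_measurable (S \<Otimes>\<^sub>M T)"
  shows "(\<lambda>x. LINT y | K x. f (x, y)) \<in> bounded_measurable S"
proof -
  have "(\<lambda>x. distr (K x) (S \<Otimes>\<^sub>M T) (Pair x)) \<in> S \<rightarrow>\<^sub>M prob_algebra (S \<Otimes>\<^sub>M T)"
    by (rule measurable_distr_prob_space2[OF K]) simp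
  note bounded_measurable_kernel_integral[OF this f]
  then show ?thesis
  proof (rule bounded_measurable_cong)
    fix x assume x: "x \<in> space S"
    have "Pair x \<in> K x \<rightarrow>\<^sub>M S \<Otimes>\<^sub>M T"
      using measurable_Pair1'[OF x, of T] space_prob_algebraD(2)[OF measurable_space[OF K x]]
      by (simp cong: measurable_cong_sets)
    then show "(LINT y | K x. f (x, y)) = (LINT z | distr (K x) (S \<Otimes>\<^sub>M T) (Pair x). f z)"
      by (rule integral_distr[OF _ f[THEN bounded_measurableD], symmetric])
  qed
qed

lemma integral_bind_prob:
  assumes P: "P \<in> space (prob_algebra S)" and K: "K \<in> S \<rightarrow>\<^sub>M prob_algebra T"
    and f: "f \<in> bounded_measurable T"
  shows "integral\<^sup>L (P \<bind> K) f = (LINT x | P. LINT y | K x. f y)"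
proof -
  interpret prob_space P by (rule space_prob_algebraD[OF P])
  note sP = space_prob_algebraD[OF P]
  obtain B where B: "\<And>x. x \<in> space T \<Longrightarrow> \<bar>f x\<bar> \<le> B"
    using f unfolding bounded_measurable_def by blast
  have K': "K \<in> P \<rightarrow>\<^sub>M subprob_algebra T"
    using measurable_prob_algebraD[OF K] sP by (simp cong: measurable_cong_sets)
  show ?thesis
  proof (rule integral_bind[where K = T and B = B and B' = 1])
    show "AE x in P. emeasure (K x) (space (K x)) \<le> ennreal 1"
      using subprob_space.emeasure_space_le_1[OF subprob_space_kernel[OF K']] by (intro AE_I2) simp
  qed (use B K' f[THEN bounded_measurableD] not_empty in \<open>auto simp: finite_measure_axioms\<close>)
qed

lemma bind_in_prob_algebra:
  assumes "P \<in> space (prob_algebra S)" "K \<in> S \<rightarrow>\<^sub>M prob_algebra T"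
  shows "P \<bind> K \<in> space (prob_algebra T)"
  using prob_space_bind'[OF assms] sets_bind'[OF assms] by (simp add: space_prob_algebra)

lemma return_in_prob_algebra: "x \<in> space S \<Longrightarrow> return S x \<in> space (prob_algebra S)"
  by (simp add: space_prob_algebra prob_space_return)

lemma kernel_cong:
  "K \<in> S \<rightarrow>\<^sub>M prob_algebra T \<Longrightarrow> x \<in> space S \<Longrightarrow> (\<And>y. y \<in> space T \<Longrightarrow> f y = g y) \<Longrightarrow>
    (LINT y | K x. f y) = (LINT y | K x. g y)"
  using space_prob_algebraD(3)[OF measurable_space, of K S T x]
  by (intro Bochner_Integration.integral_cong) auto


subsection \<open>Transfer operator and trajectories\<close>

locale mdp_policy =
  fixes M :: "('s, 'a) mdp" and \<pi> :: "'s \<Rightarrow> 'a measure"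
  assumes mdp: "is_mdp M" and policy: "is_policy M \<pi>"
begin

abbreviation "SA \<equiv> sa_space M"
abbreviation "St \<equiv> state_space M"

text \<open>Once the policy is fixed, the state-action pairs form a Markov chain; this is its
  transition kernel.\<close>

definition sa_kernel :: "'s \<times> 'a \<Rightarrow> ('s \<times> 'a) measure" where
  "sa_kernel x = act M \<pi> (transition M x)"

text \<open>The Markov operator of the chain on functions; its adjoint moves the law of the pair one
  time step ahead.\<close>

definition transfer :: "('s \<times> 'a \<Rightarrow> real) \<Rightarrow> 's \<times> 'a \<Rightarrow> real" where
  "transfer f x = (LINT y | sa_kernel x. f y)"

definition mean_reward :: "'s \<times> 'a \<Rightarrow> real" where
  "mean_reward x = (LINT r | reward M x. r)"

section \<open>One-step expectations and the Bellman operator\<close>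

lemma init: "init M \<in> space (prob_algebra St)"
  and reward: "reward M \<in> SA \<rightarrow>\<^sub>M prob_algebra reward_space"
  and transition: "transition M \<in> SA \<rightarrow>\<^sub>M prob_algebra St"
  using mdp unfolding is_mdp_def by auto

lemma pi: "\<pi> \<in> St \<rightarrow>\<^sub>M prob_algebra (action_space M)"
  using policy unfolding is_policy_def .

lemma policy_kernel: "(\<lambda>s. \<pi> s \<bind> (\<lambda>a. return SA (s, a))) \<in> St \<rightarrow>\<^sub>M prob_algebra SA"
  by (rule measurable_bind_prob_space2[OF pi]) (simp add: sa_space_def)

lemma act_in: "\<rho> \<in> space (prob_algebra St) \<Longrightarrow> act M \<pi> \<rho> \<in> space (prob_algebra SA)"
  unfolding act_def by (rule bind_in_prob_algebra[OF _ policy_kernel])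

lemma integral_policy_kernel:
  assumes s: "s \<in> space St" and f: "f \<in> bounded_measurable SA"
  shows "(LINT x | (\<pi> s \<bind> (\<lambda>a. return SA (s, a))). f x) = policy_value \<pi> f s"
proof -
  have Pair: "Pair s \<in> action_space M \<rightarrow>\<^sub>M SA"
    unfolding sa_space_def using s by simp
  have \<pi>s: "\<pi> s \<in> space (prob_algebra (action_space M))"
    using measurable_space[OF pi s] .
  have "(LINT x | (\<pi> s \<bind> (\<lambda>a. return SA (s, a))). f x) = (LINT a | \<pi> s. LINT x | return SA (s, a). f x)"
    by (rule integral_bind_prob[OF \<pi>s _ f]) (rule measurable_compose[OF Pair measurable_return_prob_space])
  also have "\<dots> = policy_value \<pi> f s"
    unfolding policy_value_def
    using space_prob_algebraD(3)[OF \<pi>s] measurable_space[OF Pair] f[THEN bounded_measurableD]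
    by (intro Bochner_Integration.integral_cong) (auto simp: integral_return)
  finally show ?thesis .
qed

lemma policy_value_bounded_measurable:
  "f \<in> bounded_measurable SA \<Longrightarrow> policy_value \<pi> f \<in> bounded_measurable St"
  unfolding policy_value_def sa_space_def by (rule bounded_measurable_parametric_integral[OF pi])

lemma integral_act:
  assumes \<rho>: "\<rho> \<in> space (prob_algebra St)" and f: "f \<in> bounded_measurable SA"
  shows "(LINT x | act M \<pi> \<rho>. f x) = (LINT s | \<rho>. policy_value \<pi> f s)"
proof -
  have "(LINT x | act M \<pi> \<rho>. f x) = (LINT s | \<rho>. LINT x | (\<pi> s \<bind> (\<lambda>a. return SA (s, a))). f x)"
    unfolding act_def by (rule integral_bind_prob[OF \<rho> policy_kernel f])
  also have "\<dots> = (LINT s | \<rho>. policy_value \<pi> f s)"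
    using space_prob_algebraD(3)[OF \<rho>]
    by (intro Bochner_Integration.integral_cong) (auto simp: integral_policy_kernel[OF _ f])
  finally show ?thesis .
qed

lemma sa_kernel: "sa_kernel \<in> SA \<rightarrow>\<^sub>M prob_algebra SA"
  unfolding sa_kernel_def act_def by (rule measurable_bind_prob_space[OF transition policy_kernel])

lemma transfer_bounded_measurable: "f \<in> bounded_measurable SA \<Longrightarrow> transfer f \<in> bounded_measurable SA"
  unfolding transfer_def by (rule bounded_measurable_kernel_integral[OF sa_kernel])

lemma transfer_funpow_bounded_measurable:
  "f \<in> bounded_measurable SA \<Longrightarrow> (transfer ^^ n) f \<in> bounded_measurable SA"
  by (induction n) (auto intro: transfer_bounded_measurable)

lemma transfer_cong:
  "x \<in> space SA \<Longrightarrow> (\<And>y. y \<in> space SA \<Longrightarrow> f y = g y) \<Longrightarrow> transfer f x = transfer g x"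
  unfolding transfer_def by (rule kernel_cong[OF sa_kernel])

lemma identity_reward: "(\<lambda>r. r) \<in> bounded_measurable reward_space"
  by (rule bounded_measurableI[where B = 1]) (auto simp: space_restrict_space intro: measurable_restrict_space1)

lemma mean_reward_bounded_measurable: "mean_reward \<in> bounded_measurable SA"
  unfolding mean_reward_def by (rule bounded_measurable_kernel_integral[OF reward identity_reward])

text \<open>By \<open>integral_act\<close> the expected next value is \<open>transfer f x\<close>,
  and constants leave both integrals because the laws have mass 1. The Bellman operator thus appears
  as an affine map whose linear part can be iterated along the chain.\<close>

lemma bellman_eq:
  assumes x: "x \<in> space SA" and f: "f \<in> bounded_measurable SA"
  shows "bellman M \<pi> \<gamma> f x = mean_reward x + \<gamma> * transfer f x"
proof -
  have T: "transition M x \<in> space (prob_algebra St)" and R: "reward M x \<in> space (prob_algebra reward_space)"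
    using measurable_space[OF transition x] measurable_space[OF reward x] .
  interpret T: prob_space "transition M x" by (rule space_prob_algebraD[OF T])
  interpret R: prob_space "reward M x" by (rule space_prob_algebraD[OF R])
  have "(LINT s' | transition M x. r + \<gamma> * policy_value \<pi> f s') = r + \<gamma> * transfer f x" for r
    using bounded_measurable_integrable[OF T policy_value_bounded_measurable[OF f]]
    by (simp add: transfer_def sa_kernel_def integral_act[OF T f] T.prob_space)
  moreover have "(LINT r | reward M x. r + \<gamma> * transfer f x) = mean_reward x + \<gamma> * transfer f x"
    using bounded_measurable_integrable[OF R identity_reward]
    by (simp add: mean_reward_def R.prob_space)
  ultimately show ?thesis by (simp add: bellman_def)
qed

section \<open>Laws of trajectories and their marginals\<close>

definition step :: "('s \<times> 'a) measure \<Rightarrow> nat \<Rightarrow> (nat \<Rightarrow> ('s \<times> 'a) \<times> real) \<Rightarrow> ('s \<times> 'a) measure" where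
  "step \<nu> n \<omega> = (if n = 0 then \<nu> else sa_kernel (fst (\<omega> n)))"

lemma state_measurable: "h \<in> {1..n} \<Longrightarrow> (\<lambda>\<omega>. fst (\<omega> h)) \<in> traj_space M n \<rightarrow>\<^sub>M SA"
  unfolding traj_space_def
  by (rule measurable_compose[OF measurable_component_singleton[where M = "\<lambda>_. SA \<Otimes>\<^sub>M reward_space"] measurable_fst])

lemma step_measurable:
  assumes \<nu>: "\<nu> \<in> space (prob_algebra SA)"
  shows "step \<nu> n \<in> traj_space M n \<rightarrow>\<^sub>M prob_algebra SA"
proof (cases "n = 0")
  case True
  then show ?thesis using \<nu> by (simp add: step_def[abs_def])
next
  case False
  then have "(\<lambda>\<omega>. fst (\<omega> n)) \<in> traj_space M n \<rightarrow>\<^sub>M SA"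
    by (intro state_measurable) auto
  from measurable_compose[OF this sa_kernel] show ?thesis
    using False by (simp add: step_def[abs_def])
qed

text \<open>The nested binds of \<open>trajectory\<close> need path extension to be measurable
  jointly in path, pair and reward; after regrouping it is the standard map adding a coordinate to a
  product space.\<close>

lemma traj_extend:
  "(\<lambda>((\<omega>, x), r). fun_upd \<omega> (Suc n) (x, r)) \<in>
    (traj_space M n \<Otimes>\<^sub>M SA) \<Otimes>\<^sub>M reward_space \<rightarrow>\<^sub>M traj_space M (Suc n)"
proof -
  have "(\<lambda>z. (\<lambda>(f, y). f(Suc n := y)) (fst (fst z), (snd (fst z), snd z))) \<in>
    (traj_space M n \<Otimes>\<^sub>M SA) \<Otimes>\<^sub>M reward_space \<rightarrow>\<^sub>M Pi\<^sub>M (insert (Suc n) {1..n}) (\<lambda>_. SA \<Otimes>\<^sub>M reward_space)"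
    by (rule measurable_compose[OF _ measurable_add_dim]) (simp add: traj_space_def)
  moreover have "insert (Suc n) {1..n} = {1..Suc n}" by auto
  ultimately show ?thesis
    by (simp only: traj_space_def case_prod_beta' fst_conv snd_conv)
qed

lemma extend_kernel:
  "(\<lambda>(\<omega>, x). reward M x \<bind> (\<lambda>r. return (traj_space M (Suc n)) (fun_upd \<omega> (Suc n) (x, r)))) \<in>
    traj_space M n \<Otimes>\<^sub>M SA \<rightarrow>\<^sub>M prob_algebra (traj_space M (Suc n))"
proof -
  have "(\<lambda>z. reward M (snd z) \<bind> (\<lambda>r. return (traj_space M (Suc n)) (fun_upd (fst z) (Suc n) (snd z, r)))) \<in>
    traj_space M n \<Otimes>\<^sub>M SA \<rightarrow>\<^sub>M prob_algebra (traj_space M (Suc n))"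
    by (rule measurable_bind_prob_space2[OF measurable_compose[OF measurable_snd reward]])
      (use measurable_compose[OF traj_extend measurable_return_prob_space] in \<open>simp add: case_prod_beta'\<close>)
  then show ?thesis by (simp add: case_prod_beta')
qed

lemma step_kernel:
  assumes \<nu>: "\<nu> \<in> space (prob_algebra SA)"
  shows "(\<lambda>\<omega>. step \<nu> n \<omega> \<bind> (\<lambda>x. reward M x \<bind> (\<lambda>r. return (traj_space M (Suc n)) (fun_upd \<omega> (Suc n) (x, r))))) \<in>
    traj_space M n \<rightarrow>\<^sub>M prob_algebra (traj_space M (Suc n))"
  by (rule measurable_bind_prob_space2[OF step_measurable[OF \<nu>] extend_kernel])

lemma trajectory_Suc:
  "trajectory M \<pi> \<nu> (Suc n) = trajectory M \<pi> \<nu> n \<bind> (\<lambda>\<omega>. step \<nu> n \<omega> \<bind>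
     (\<lambda>x. reward M x \<bind> (\<lambda>r. return (traj_space M (Suc n)) (fun_upd \<omega> (Suc n) (x, r)))))"
  unfolding trajectory.simps step_def sa_kernel_def ..

lemma trajectory_in:
  assumes \<nu>: "\<nu> \<in> space (prob_algebra SA)"
  shows "trajectory M \<pi> \<nu> n \<in> space (prob_algebra (traj_space M n))"
proof (induction n)
  case 0
  show ?case by (simp add: return_in_prob_algebra traj_space_def space_PiM)
next
  case (Suc n)
  show ?case
    unfolding trajectory_Suc by (rule bind_in_prob_algebra[OF Suc step_kernel[OF \<nu>]])
qed

text \<open>One application of Fubini per \<open>bind\<close> peels off the last time step, the
  final \<open>return\<close> being an evaluation.\<close>

lemma integral_trajectory_Suc:
  assumes \<nu>: "\<nu> \<in> space (prob_algebra SA)" and f: "f \<in> bounded_measurable (traj_space M (Suc n))"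
  shows "(LINT \<omega> | trajectory M \<pi> \<nu> (Suc n). f \<omega>) =
    (LINT \<omega> | trajectory M \<pi> \<nu> n. LINT x | step \<nu> n \<omega>. LINT r | reward M x. f (fun_upd \<omega> (Suc n) (x, r)))"
proof -
  have "(LINT \<eta> | (step \<nu> n \<omega> \<bind> (\<lambda>x. reward M x \<bind> (\<lambda>r. return (traj_space M (Suc n)) (fun_upd \<omega> (Suc n) (x, r))))). f \<eta>)
     = (LINT x | step \<nu> n \<omega>. LINT r | reward M x. f (fun_upd \<omega> (Suc n) (x, r)))"
    if \<omega>: "\<omega> \<in> space (traj_space M n)" for \<omega>
  proof -
    have st: "step \<nu> n \<omega> \<in> space (prob_algebra SA)"
      using measurable_space[OF step_measurable[OF \<nu>] \<omega>] .
    have "(LINT \<eta> | (reward M x \<bind> (\<lambda>r. return (traj_space M (Suc n)) (fun_upd \<omega> (Suc n) (x, r)))). f \<eta>)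
       = (LINT r | reward M x. f (fun_upd \<omega> (Suc n) (x, r)))" if x: "x \<in> space SA" for x
    proof -
      have R: "reward M x \<in> space (prob_algebra reward_space)"
        using measurable_space[OF reward x] .
      have up: "(\<lambda>r. fun_upd \<omega> (Suc n) (x, r)) \<in> reward_space \<rightarrow>\<^sub>M traj_space M (Suc n)"
        using measurable_compose[OF _ traj_extend, of "\<lambda>r. ((\<omega>, x), r)" reward_space n] \<omega> x by simp
      have "(LINT \<eta> | (reward M x \<bind> (\<lambda>r. return (traj_space M (Suc n)) (fun_upd \<omega> (Suc n) (x, r)))). f \<eta>)
         = (LINT r | reward M x. LINT \<eta> | return (traj_space M (Suc n)) (fun_upd \<omega> (Suc n) (x, r)). f \<eta>)"
        by (rule integral_bind_prob[OF R measurable_compose[OF up measurable_return_prob_space] f])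
      also have "\<dots> = (LINT r | reward M x. f (fun_upd \<omega> (Suc n) (x, r)))"
        using space_prob_algebraD(3)[OF R] measurable_space[OF up] f[THEN bounded_measurableD]
        by (intro Bochner_Integration.integral_cong) (auto simp: integral_return)
      finally show ?thesis .
    qed
    moreover have "(\<lambda>x. reward M x \<bind> (\<lambda>r. return (traj_space M (Suc n)) (fun_upd \<omega> (Suc n) (x, r)))) \<in>
      SA \<rightarrow>\<^sub>M prob_algebra (traj_space M (Suc n))"
      using measurable_compose[OF _ extend_kernel, of "Pair \<omega>" SA n] \<omega> by simp
    ultimately show ?thesis
      using space_prob_algebraD(3)[OF st]
      by (subst integral_bind_prob[OF st _ f]) (auto intro: Bochner_Integration.integral_cong)
  qed
  then show ?thesis
    unfolding trajectory_Suc using space_prob_algebraD(3)[OF trajectory_in[OF \<nu>]]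
    by (subst integral_bind_prob[OF trajectory_in[OF \<nu>] step_kernel[OF \<nu>] f])
      (auto intro: Bochner_Integration.integral_cong)
qed

lemma measure_reward: "x \<in> space SA \<Longrightarrow> measure (reward M x) (space (reward M x)) = 1"
  by (rule prob_space.prob_space[OF space_prob_algebraD(1)[OF measurable_space[OF reward]]])

lemma transfer_funpow_cong:
  assumes "x \<in> space SA" "\<And>y. y \<in> space SA \<Longrightarrow> f y = g y"
  shows "(transfer ^^ n) f x = (transfer ^^ n) g x"
  using assms(1) by (induction n arbitrary: x) (auto intro: transfer_cong assms(2))

lemma bounded_measurable_component:
  assumes "g \<in> bounded_measurable (SA \<Otimes>\<^sub>M reward_space)" "h \<in> {1..n}"
  shows "(\<lambda>\<omega>. g (\<omega> h)) \<in> bounded_measurable (traj_space M n)"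
  using assms unfolding traj_space_def
  by (intro bounded_measurable_compose[OF assms(1)] measurable_component_singleton)

text \<open>Integrating out the last pair and reward leaves a function of the previous pair alone.
  The integrand changes in the process, so the induction hypothesis is needed for all
  \<open>g\<close> at once.\<close>

lemma integral_trajectory_last:
  assumes \<nu>: "\<nu> \<in> space (prob_algebra SA)" and g: "g \<in> bounded_measurable (SA \<Otimes>\<^sub>M reward_space)"
  shows "(LINT \<omega> | trajectory M \<pi> \<nu> (Suc n). g (\<omega> (Suc n))) =
    (LINT x | \<nu>. (transfer ^^ n) (\<lambda>x. LINT r | reward M x. g (x, r)) x)"
  using g
proof (induction n arbitrary: g)
  case 0
  \<comment> \<open>The integrand does not depend on the empty path, so only the total mass 1 of
    this law matters.\<close>
  interpret prob_space "trajectory M \<pi> \<nu> 0"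
    by (rule space_prob_algebraD[OF trajectory_in[OF \<nu>]])
  show ?case
    by (subst integral_trajectory_Suc[OF \<nu> bounded_measurable_component[OF 0]])
      (auto simp: step_def simp del: trajectory.simps simp: prob_space)
next
  case (Suc n)
  define g' where "g' x = (LINT r | reward M x. g (x, r))" for x
  have bm: "g' \<in> bounded_measurable SA"
    unfolding g'_def by (rule bounded_measurable_parametric_integral[OF reward Suc.prems])
  have "(LINT \<omega> | trajectory M \<pi> \<nu> (Suc (Suc n)). g (\<omega> (Suc (Suc n)))) =
    (LINT \<omega> | trajectory M \<pi> \<nu> (Suc n). transfer g' (fst (\<omega> (Suc n))))"
    by (subst integral_trajectory_Suc[OF \<nu> bounded_measurable_component[OF Suc.prems]])
      (auto simp: step_def g'_def transfer_def simp del: trajectory.simps)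
  \<comment> \<open>The hypothesis is applied to \<open>transfer g'\<close> read as a function of
    pair and reward that ignores the reward; the reward integral then disappears by mass 1.\<close>
  also have "\<dots> = (LINT x | \<nu>. (transfer ^^ n) (\<lambda>x. LINT r | reward M x. transfer g' (fst (x, r))) x)"
    by (rule Suc.IH) (rule bounded_measurable_compose[OF transfer_bounded_measurable[OF bm] measurable_fst])
  also have "\<dots> = (LINT x | \<nu>. (transfer ^^ Suc n) g' x)"
    unfolding funpow_Suc_right o_def
    using space_prob_algebraD(3)[OF \<nu>]
    by (intro Bochner_Integration.integral_cong transfer_funpow_cong) (auto simp: measure_reward)
  finally show ?case unfolding g'_def .
qed

lemma integral_state_trajectory:
  assumes \<nu>: "\<nu> \<in> space (prob_algebra SA)" and f: "f \<in> bounded_measurable SA"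
  shows "(LINT \<omega> | trajectory M \<pi> \<nu> (Suc n). f (fst (\<omega> (Suc n)))) = (LINT x | \<nu>. (transfer ^^ n) f x)"
  unfolding integral_trajectory_last[OF \<nu> bounded_measurable_compose[OF f measurable_fst]]
  using space_prob_algebraD(3)[OF \<nu>]
  by (intro Bochner_Integration.integral_cong transfer_funpow_cong) (auto simp: measure_reward)

text \<open>Steps after time \<open>Suc h\<close> leave that coordinate unchanged and integrate to
  mass 1, so prolonging the trajectory does not alter the expectation.\<close>

lemma integral_component_trajectory:
  assumes \<nu>: "\<nu> \<in> space (prob_algebra SA)" and g: "g \<in> bounded_measurable (SA \<Otimes>\<^sub>M reward_space)"
    and "Suc h \<le> n"
  shows "(LINT \<omega> | trajectory M \<pi> \<nu> n. g (\<omega> (Suc h))) =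
    (LINT x | \<nu>. (transfer ^^ h) (\<lambda>x. LINT r | reward M x. g (x, r)) x)"
  using assms(3)
proof (induction n rule: dec_induct)
  case base
  show ?case by (rule integral_trajectory_last[OF \<nu> g])
next
  case (step n)
  have "(LINT x | step \<nu> n \<omega>. LINT r | reward M x. g ((fun_upd \<omega> (Suc n) (x, r)) (Suc h))) = g (\<omega> (Suc h))"
    if \<omega>: "\<omega> \<in> space (traj_space M n)" for \<omega>
  proof -
    note st = space_prob_algebraD[OF measurable_space[OF step_measurable[OF \<nu>] \<omega>]]
    interpret prob_space "step \<nu> n \<omega>" by (rule st)
    have "(LINT x | step \<nu> n \<omega>. LINT r | reward M x. g ((fun_upd \<omega> (Suc n) (x, r)) (Suc h)))
       = (LINT x | step \<nu> n \<omega>. g (\<omega> (Suc h)))"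
      using step.hyps st(3) by (intro Bochner_Integration.integral_cong) (auto simp: measure_reward)
    then show ?thesis by (simp add: prob_space)
  qed
  then have "(LINT \<omega> | trajectory M \<pi> \<nu> (Suc n). g (\<omega> (Suc h))) = (LINT \<omega> | trajectory M \<pi> \<nu> n. g (\<omega> (Suc h)))"
    using step.hyps space_prob_algebraD(3)[OF trajectory_in[OF \<nu>]]
    by (subst integral_trajectory_Suc[OF \<nu> bounded_measurable_component[OF g]])
      (auto intro!: Bochner_Integration.integral_cong simp del: fun_upd_apply)
  then show ?case using step.IH by simp
qed

text \<open>Time 1 carries the initial law, so time \<open>Suc n\<close> corresponds to
  \<open>n\<close> applications of the operator.\<close>

lemma sa_dist_in: "1 \<le> h \<Longrightarrow> sa_dist M \<pi> h \<in> space (prob_algebra SA)"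
  and integral_sa_dist: "f \<in> bounded_measurable SA \<Longrightarrow>
    (LINT x | sa_dist M \<pi> (Suc n). f x) = (LINT x | act M \<pi> (init M). (transfer ^^ n) f x)"
proof -
  have m: "(\<lambda>\<omega>. fst (\<omega> h)) \<in> trajectory M \<pi> (act M \<pi> (init M)) h \<rightarrow>\<^sub>M SA" if "1 \<le> h" for h
  proof -
    have "(\<lambda>\<omega>. fst (\<omega> h)) \<in> traj_space M h \<rightarrow>\<^sub>M SA"
      using that by (intro state_measurable) auto
    then show ?thesis
      using space_prob_algebraD(2)[OF trajectory_in[OF act_in[OF init]]] by (simp cong: measurable_cong_sets)
  qed
  show "sa_dist M \<pi> h \<in> space (prob_algebra SA)" if "1 \<le> h"
    using prob_space.prob_space_distr[OF space_prob_algebraD(1)[OF trajectory_in[OF act_in[OF init]]] m[OF that]]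
    by (simp add: space_prob_algebra sa_dist_def)
  show "(LINT x | sa_dist M \<pi> (Suc n). f x) = (LINT x | act M \<pi> (init M). (transfer ^^ n) f x)"
    if f: "f \<in> bounded_measurable SA"
    unfolding integral_state_trajectory[OF act_in[OF init] f, symmetric] sa_dist_def
    using m[of "Suc n"] f[THEN bounded_measurableD] by (simp add: integral_distr del: trajectory.simps)
qed

text \<open>The extra power of the operator is absorbed by moving the law one step ahead, which is
  the mechanism that unrolls the iteration below.\<close>

lemma integral_sa_dist_transfer:
  "f \<in> bounded_measurable SA \<Longrightarrow>
    (LINT x | sa_dist M \<pi> (Suc n). transfer f x) = (LINT x | sa_dist M \<pi> (Suc (Suc n)). f x)"
  by (simp add: integral_sa_dist transfer_bounded_measurable funpow_Suc_right del: funpow.simps)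

section \<open>Expected discounted rewards of the policy\<close>

lemma action_value_eq:
  assumes x: "x \<in> space SA"
  shows "action_value M \<pi> H \<gamma> x = (\<Sum>h = 1..H. \<gamma> ^ (h - 1) * (transfer ^^ (h - 1)) mean_reward x)"
proof -
  have \<nu>: "return SA x \<in> space (prob_algebra SA)" using x by (rule return_in_prob_algebra)
  have snd: "snd \<in> bounded_measurable (SA \<Otimes>\<^sub>M reward_space)"
    by (rule bounded_measurable_compose[OF identity_reward measurable_snd])
  \<comment> \<open>Started at the point mass at \<open>x\<close>, the \<open>h\<close>-th reward is
    averaged after \<open>h - 1\<close> transitions, since time 1 is the start itself.\<close>
  have E: "(LINT \<omega> | trajectory M \<pi> (return SA x) H. snd (\<omega> h)) = (transfer ^^ (h - 1)) mean_reward x"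
    if "h \<in> {1..H}" for h
    using integral_component_trajectory[OF \<nu> snd, of "h - 1" H] that
      transfer_funpow_bounded_measurable[OF mean_reward_bounded_measurable, THEN bounded_measurableD] x
    by (simp add: integral_return mean_reward_def[abs_def])
  have "integrable (trajectory M \<pi> (return SA x) H) (\<lambda>\<omega>. snd (\<omega> h))" if "h \<in> {1..H}" for h
    by (rule bounded_measurable_integrable[OF trajectory_in[OF \<nu>] bounded_measurable_component[OF snd that]])
  then have "action_value M \<pi> H \<gamma> x =
      (\<Sum>h = 1..H. LINT \<omega> | trajectory M \<pi> (return SA x) H. \<gamma> ^ (h - 1) * snd (\<omega> h))"
    unfolding action_value_def by (intro Bochner_Integration.integral_sum integrable_mult_right)
  also have "\<dots> = (\<Sum>h = 1..H. \<gamma> ^ (h - 1) * (transfer ^^ (h - 1)) mean_reward x)"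
    by (intro sum.cong refl) (simp only: integral_mult_right_zero E)
  finally show ?thesis .
qed

lemma J_action_value:
  "J M \<pi> (action_value M \<pi> H \<gamma>) = (\<Sum>h = 1..H. \<gamma> ^ (h - 1) * (LINT x | sa_dist M \<pi> h. mean_reward x))"
proof -
  let ?Q = "\<lambda>x. \<Sum>h = 1..H. \<gamma> ^ (h - 1) * (transfer ^^ (h - 1)) mean_reward x"
  note \<nu> = act_in[OF init]
  \<comment> \<open>Stated for an arbitrary finite index set so that induction over finite sets
    applies.\<close>
  have Q: "(\<lambda>x. \<Sum>h \<in> A. \<gamma> ^ (h - 1) * (transfer ^^ (h - 1)) mean_reward x) \<in> bounded_measurable SA"
    if "finite A" for A
    using that
    by induction (auto intro!: bounded_measurable_const bounded_measurable_add bounded_measurable_cmult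
      transfer_funpow_bounded_measurable mean_reward_bounded_measurable)
  have "J M \<pi> (action_value M \<pi> H \<gamma>) = J M \<pi> ?Q"
    unfolding J_def policy_value_def
  proof (intro Bochner_Integration.integral_cong refl)
    fix s a assume "s \<in> space (init M)" and a: "a \<in> space (\<pi> s)"
    then have s: "s \<in> space St" using space_prob_algebraD(3)[OF init] by simp
    then show "action_value M \<pi> H \<gamma> (s, a) = ?Q (s, a)"
      using a space_prob_algebraD(3)[OF measurable_space[OF pi s]]
      by (intro action_value_eq) (simp add: sa_space_def space_pair_measure)
  qed
  also have "\<dots> = (LINT x | act M \<pi> (init M). ?Q x)"
    unfolding J_def by (rule integral_act[OF init Q, symmetric]) simp
  also have "\<dots> = (\<Sum>h = 1..H. \<gamma> ^ (h - 1) * (LINT x | act M \<pi> (init M). (transfer ^^ (h - 1)) mean_reward x))"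
    using bounded_measurable_integrable[OF \<nu> transfer_funpow_bounded_measurable[OF mean_reward_bounded_measurable]]
    by (simp add: Bochner_Integration.integral_sum)
  also have "\<dots> = (\<Sum>h = 1..H. \<gamma> ^ (h - 1) * (LINT x | sa_dist M \<pi> h. mean_reward x))"
  proof (intro sum.cong refl)
    fix h assume "h \<in> {1..H}"
    then show "\<gamma> ^ (h - 1) * (LINT x | act M \<pi> (init M). (transfer ^^ (h - 1)) mean_reward x) =
      \<gamma> ^ (h - 1) * (LINT x | sa_dist M \<pi> h. mean_reward x)"
      using integral_sa_dist[OF mean_reward_bounded_measurable, of "h - 1"] by simp
  qed
  finally show ?thesis .
qed

section \<open>Unrolling the approximate value iteration\<close>

lemma value_functions_bounded: "f \<in> value_functions M c \<Longrightarrow> f \<in> bounded_measurable SA"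
  unfolding value_functions_def by (auto intro!: bounded_measurableI[where B = c])

lemma bellman_bounded_measurable:
  assumes f: "f \<in> bounded_measurable SA"
  shows "bellman M \<pi> \<gamma> f \<in> bounded_measurable SA"
proof -
  show ?thesis
  proof (rule bounded_measurable_cong[OF _ bellman_eq[OF _ f]])
    show "(\<lambda>x. mean_reward x + \<gamma> * transfer f x) \<in> bounded_measurable SA"
      by (intro bounded_measurable_add bounded_measurable_cmult transfer_bounded_measurable
        mean_reward_bounded_measurable f)
  qed
qed

lemma Q_iter_in:
  assumes "X \<in> operators M c" "0 \<le> c"
  shows "Q_iter X h \<in> value_functions M c"
proof (induction h)
  case 0
  show ?case using assms(2) by (simp add: Q_iter_def value_functions_def)
next
  case (Suc h)
  then show ?case using assms(1) by (auto simp: Q_iter_def operators_def)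
qed

lemma \<Delta>op_bounded_measurable:
  assumes "X \<in> operators M c" "f \<in> value_functions M c"
  shows "\<Delta>op M \<pi> \<gamma> X f \<in> bounded_measurable SA"
  using assms unfolding \<Delta>op_def operators_def
  by (intro bounded_measurable_diff bellman_bounded_measurable value_functions_bounded[where c = c]) auto

text \<open>Each new iterate is its own error plus the mean reward plus \<open>\<gamma>\<close>
  times the transfer of the preceding iterate, and the transfer is absorbed by shifting time; hence
  the induction keeps the start time \<open>n\<close> general. The error of iteration
  \<open>i\<close> ends up \<open>h - i\<close> transitions ahead, which explains its discount and
  its time index.\<close>

lemma integral_Q_iter:
  assumes X: "X \<in> operators M c" and c: "0 \<le> c"
  shows "(LINT x | sa_dist M \<pi> (Suc n). Q_iter X h x) =
    (\<Sum>i = 1..h. \<gamma> ^ (h - i) * ((LINT x | sa_dist M \<pi> (Suc (n + h - i)). \<Delta>op M \<pi> \<gamma> X (Q_iter X (i - 1)) x)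
      + (LINT x | sa_dist M \<pi> (Suc (n + h - i)). mean_reward x)))"
proof (induction h arbitrary: n)
  case 0
  show ?case by (simp add: Q_iter_def)
next
  case (Suc h)
  let ?g = "\<Delta>op M \<pi> \<gamma> X (Q_iter X h)"
  let ?P = "sa_dist M \<pi> (Suc n)"
  have P: "?P \<in> space (prob_algebra SA)" by (rule sa_dist_in) simp
  have Q: "Q_iter X h \<in> bounded_measurable SA"
    by (rule value_functions_bounded[OF Q_iter_in[OF X c]])
  have g: "?g \<in> bounded_measurable SA"
    by (rule \<Delta>op_bounded_measurable[OF X Q_iter_in[OF X c]])
  have "(LINT x | ?P. Q_iter X (Suc h) x) = (LINT x | ?P. ?g x + mean_reward x + \<gamma> * transfer (Q_iter X h) x)"
    using space_prob_algebraD(3)[OF P]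
    by (intro Bochner_Integration.integral_cong) (auto simp: \<Delta>op_def bellman_eq[OF _ Q], simp add: Q_iter_def)
  also have "\<dots> = (LINT x | ?P. ?g x) + (LINT x | ?P. mean_reward x) + \<gamma> * (LINT x | ?P. transfer (Q_iter X h) x)"
    using bounded_measurable_integrable[OF P g] bounded_measurable_integrable[OF P mean_reward_bounded_measurable]
      bounded_measurable_integrable[OF P transfer_bounded_measurable[OF Q]] by simp
  also have "(LINT x | ?P. transfer (Q_iter X h) x) = (LINT x | sa_dist M \<pi> (Suc (Suc n)). Q_iter X h x)"
    by (rule integral_sa_dist_transfer[OF Q])
  finally show ?case
    by (simp add: Suc.IH sum_distrib_left Suc_diff_le algebra_simps)
qed

text \<open>For \<open>n = 0\<close> the mean-reward terms of \<open>integral_Q_iter\<close> are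
  exactly the discounted rewards making up the value of the policy. They cancel, and the errors
  remain with equality.\<close>

lemma \<Delta>J_decomposition:
  assumes X: "X \<in> operators M c" and c: "0 \<le> c"
  shows "\<Delta>J M \<pi> H \<gamma> (Q_iter X H) =
    (\<Sum>h = 1..H. \<gamma> ^ (H - h) * (LINT x | sa_dist M \<pi> (Suc (H - h)). \<Delta>op M \<pi> \<gamma> X (Q_iter X (h - 1)) x))"
proof -
  have Q: "Q_iter X H \<in> bounded_measurable SA"
    by (rule value_functions_bounded[OF Q_iter_in[OF X c]])
  have "J M \<pi> (Q_iter X H) = (LINT x | sa_dist M \<pi> (Suc 0). Q_iter X H x)"
    unfolding J_def integral_act[OF init Q, symmetric] using integral_sa_dist[OF Q, of 0] by simp
  \<comment> \<open>Substituting \<open>H + 1 - h\<close> for \<open>h\<close> turns the exponent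
    \<open>h - 1\<close> into \<open>H - h\<close> and matches the time indices.\<close>
  moreover have "J M \<pi> (action_value M \<pi> H \<gamma>) =
    (\<Sum>h = 1..H. \<gamma> ^ (H - h) * (LINT x | sa_dist M \<pi> (Suc (H - h)). mean_reward x))"
    unfolding J_action_value by (subst sum.atLeastAtMost_rev) (auto intro!: sum.cong simp: Suc_diff_le)
  ultimately show ?thesis
    unfolding \<Delta>J_def integral_Q_iter[OF X c, where n = 0 and \<gamma> = \<gamma>]
    by (simp add: ring_distribs sum.distrib)
qed

end

subsection \<open>Link functions and dual norms\<close>

text \<open>A pair encodes intercept and slope of an affine function. Small intercepts give the
  value 0 and continuity at 0, where concavity alone would allow a jump; elsewhere continuity
  follows from concavity.\<close>

lemma link_function_INF_affine:
  fixes S :: "(real \<times> real) set"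
  assumes pos: "\<And>p. p \<in> S \<Longrightarrow> 0 \<le> fst p \<and> 0 \<le> snd p"
    and small: "\<And>e. 0 < e \<Longrightarrow> \<exists>p \<in> S. fst p < e"
  shows "link_function (\<lambda>y. INF p \<in> S. fst p + snd p * y)"
proof -
  define \<phi> where "\<phi> y = (INF p \<in> S. fst p + snd p * y)" for y
  have ne: "S \<noteq> {}" using small[of 1] by auto
  \<comment> \<open>The restriction to \<open>0 \<le> y\<close> matters: for negative
    \<open>y\<close> the values may be unbounded below, and the real infimum is then
    unspecified.\<close>
  have bdd: "bdd_below ((\<lambda>p. fst p + snd p * y) ` S)" if "0 \<le> y" for y
    using that pos by (intro bdd_belowI2[where m = 0]) simp
  have lower: "\<phi> y \<le> fst p + snd p * y" if "p \<in> S" "0 \<le> y" for p y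
    unfolding \<phi>_def using that by (intro cINF_lower bdd)
  have greatest: "c \<le> \<phi> y" if "\<And>p. p \<in> S \<Longrightarrow> c \<le> fst p + snd p * y" for c y
    unfolding \<phi>_def using ne that by (rule cINF_greatest)
  have nonneg: "0 \<le> \<phi> y" if "0 \<le> y" for y
    using that pos by (intro greatest) simp
  have mono: "mono_on {0..} \<phi>"
  proof (rule mono_onI)
    fix x y :: real assume xy: "x \<in> {0..}" "y \<in> {0..}" "x \<le> y"
    show "\<phi> x \<le> \<phi> y"
    proof (rule greatest)
      fix p assume p: "p \<in> S"
      have "\<phi> x \<le> fst p + snd p * x" using lower p xy by simp
      also have "\<dots> \<le> fst p + snd p * y" using pos[OF p] xy by (simp add: mult_left_mono)
      finally show "\<phi> x \<le> fst p + snd p * y" .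
    qed
  qed
  have concave: "concave_on {0..} \<phi>"
    unfolding concave_on_iff
  proof (intro conjI ballI allI impI)
    fix x y u v :: real assume xy: "x \<in> {0..}" "y \<in> {0..}" and uv: "0 \<le> u" "0 \<le> v" "u + v = 1"
    show "u * \<phi> x + v * \<phi> y \<le> \<phi> (u *\<^sub>R x + v *\<^sub>R y)"
    proof (rule greatest)
      fix p assume p: "p \<in> S"
      have "u * \<phi> x + v * \<phi> y \<le> u * (fst p + snd p * x) + v * (fst p + snd p * y)"
        using lower[OF p] xy uv by (intro add_mono mult_left_mono) auto
      also have "\<dots> = (u + v) * fst p + snd p * (u *\<^sub>R x + v *\<^sub>R y)"
        by (simp add: algebra_simps)
      finally show "u * \<phi> x + v * \<phi> y \<le> fst p + snd p * (u *\<^sub>R x + v *\<^sub>R y)"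
        using uv by simp
    qed
  qed simp
  have zero: "\<phi> 0 = 0"
  proof (rule antisym)
    show "\<phi> 0 \<le> 0"
    proof (rule field_le_epsilon)
      fix e :: real assume "0 < e"
      then obtain p where "p \<in> S" "fst p < e" using small by blast
      then show "\<phi> 0 \<le> 0 + e" using lower[of p 0] by simp
    qed
  qed (rule nonneg, simp)
  have "continuous (at x within {0..}) \<phi>" if x: "x \<in> {0..}" for x
  proof (cases "x = 0")
    case False
    \<comment> \<open>Continuity of convex functions is available on open domains, so it is applied
      to the negative on \<open>{0<..}\<close>.\<close>
    have "convex_on {0<..} (\<lambda>y. - \<phi> y)"
      using concave unfolding concave_on_def by (rule convex_on_subset) auto
    then have "continuous_on {0<..} (\<lambda>y. - (- \<phi> y))"
      by (intro continuous_on_minus convex_on_continuous) auto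
    then have "isCont \<phi> x"
      using x False by (auto simp: continuous_on_eq_continuous_at)
    then show ?thesis by (rule continuous_at_imp_continuous_within)
  next
    case True
    show ?thesis
      unfolding continuous_within_eps_delta
    proof (intro allI impI)
      fix e :: real assume "0 < e"
      then obtain p where p: "p \<in> S" "fst p < e / 2" using small[of "e / 2"] by auto
      \<comment> \<open>Below \<open>d\<close> the slope contributes at most \<open>e / 2\<close>,
        which leaves room for the intercept; the added 1 keeps the denominator positive for slope
        0.\<close>
      define d where "d = e / (2 * (snd p + 1))"
      have d: "0 < d" "(snd p + 1) * d = e / 2"
        using pos[OF p(1)] \<open>0 < e\<close> by (auto simp: d_def field_simps)
      have "\<bar>\<phi> y - \<phi> x\<bar> < e" if "y \<in> {0..}" "\<bar>y - x\<bar> < d" for y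
      proof -
        have y: "0 \<le> y" "y < d" using that True by auto
        have "\<phi> y \<le> fst p + snd p * y" using lower p y by simp
        also have "\<dots> \<le> fst p + (snd p + 1) * d"
          using y pos[OF p(1)] by (intro add_left_mono mult_mono) auto
        also have "\<dots> < e" using p d by simp
        finally show ?thesis using nonneg[OF y(1)] zero True by simp
      qed
      then show "\<exists>d>0. \<forall>x'\<in>{0..}. dist x' x < d \<longrightarrow> dist (\<phi> x') (\<phi> x) < e"
        using d(1) unfolding dist_real_def by blast
    qed
  qed
  then have "continuous_on {0..} \<phi>" by (simp add: continuous_on_eq_continuous_within)
  then have "link_function \<phi>"
    using nonneg mono concave zero unfolding link_function_def by blast
  then show ?thesis by (simp add: \<phi>_def[abs_def])
qed

section \<open>Pairing of a Banach subspace with bounded functions\<close>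

context
  fixes \<mu> :: "'x measure" and F :: "('x \<Rightarrow> real) set" and N :: "('x \<Rightarrow> real) \<Rightarrow> real"
  assumes F: "banach_subspace_L1 \<mu> F N"
begin

lemma subspace_integrable: "f \<in> F \<Longrightarrow> integrable \<mu> f"
  and subspace_cmult: "f \<in> F \<Longrightarrow> (\<lambda>x. c * f x) \<in> F"
  and subspace_norm_cmult: "f \<in> F \<Longrightarrow> N (\<lambda>x. c * f x) = \<bar>c\<bar> * N f"
  and subspace_norm_nonneg: "f \<in> F \<Longrightarrow> 0 \<le> N f"
  and subspace_norm_eq_0: "f \<in> F \<Longrightarrow> N f = 0 \<Longrightarrow> AE x in \<mu>. f x = 0"
  and subspace_zero: "(\<lambda>_. 0) \<in> F" "N (\<lambda>_. 0) = 0"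
  using F unfolding banach_subspace_L1_def by (blast, blast, blast, blast, blast, blast, auto)

text \<open>A Hoelder inequality by homogeneity: \<open>f\<close> scaled by \<open>1 / N f\<close>,
  with either sign, lies in the unit ball defining the dual norm. If \<open>N f = 0\<close>, then
  \<open>f\<close> vanishes almost everywhere and both sides are 0.\<close>

lemma abs_integral_le_dual_norm:
  assumes f: "f \<in> F" and g: "g \<in> bounded_measurable \<mu>"
  shows "\<bar>LINT x | \<mu>. f x * g x\<bar> \<le> N f * dual_norm \<mu> F N g"
proof (cases "N f = 0")
  case True
  then have "(LINT x | \<mu>. f x * g x) = 0"
    using subspace_norm_eq_0[OF f] by (intro integral_eq_zero_AE) auto
  then show ?thesis using True by simp
next
  case False
  then have pos: "0 < N f" using subspace_norm_nonneg[OF f] by simp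
  obtain B where B: "\<And>x. x \<in> space \<mu> \<Longrightarrow> \<bar>g x\<bar> \<le> B"
    using g unfolding bounded_measurable_def by blast
  have le: "c * (LINT x | \<mu>. f x * g x) \<le> dual_norm \<mu> F N g" if "\<bar>c\<bar> * N f \<le> 1" for c
  proof -
    have "(LINT x | \<mu>. (c * f x) * g x) \<le> dual_norm \<mu> F N g"
      unfolding dual_norm_def
      using that subspace_cmult[OF f] subspace_norm_cmult[OF f]
      by (intro cSUP_upper[where f = "\<lambda>f. LINT x | \<mu>. f x * g x"] dual_norm_bdd[OF F g[THEN bounded_measurableD] B]) auto
    then show ?thesis by (simp add: mult.assoc)
  qed
  show ?thesis
    using le[of "1 / N f"] le[of "- (1 / N f)"] pos by (auto simp: abs_le_iff field_simps)
qed

text \<open>The zero function lies in the unit ball. The sign is needed later to replace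
  \<open>N (f k)\<close> by a larger factor in front of the dual norm.\<close>

lemma dual_norm_nonneg:
  assumes "g \<in> bounded_measurable \<mu>"
  shows "0 \<le> dual_norm \<mu> F N g"
proof -
  obtain B where B: "\<And>x. x \<in> space \<mu> \<Longrightarrow> \<bar>g x\<bar> \<le> B"
    using assms unfolding bounded_measurable_def by blast
  have "(LINT x | \<mu>. 0 * g x) \<le> dual_norm \<mu> F N g"
    unfolding dual_norm_def using subspace_zero
    by (intro cSUP_upper[where f = "\<lambda>f. LINT x | \<mu>. f x * g x" and x = "\<lambda>_. 0"]
        dual_norm_bdd[OF F assms[THEN bounded_measurableD] B]) auto
  then show ?thesis by simp
qed

text \<open>The weight \<open>w\<close> may lie outside \<open>F\<close>. Only its part
  \<open>f\<close> is paired through the dual norm; the remainder \<open>w - f\<close> is merely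
  integrable and is paired with the uniform bound on \<open>g\<close>.\<close>

lemma abs_integral_le_approximation:
  assumes w: "integrable \<mu> w" and f: "f \<in> F" and g: "g \<in> borel_measurable \<mu>"
    and B: "\<And>x. x \<in> space \<mu> \<Longrightarrow> \<bar>g x\<bar> \<le> B"
  shows "\<bar>LINT x | \<mu>. w x * g x\<bar> \<le> B * norm_L1 \<mu> (\<lambda>x. w x - f x) + N f * dual_norm \<mu> F N g"
proof -
  have int: "integrable \<mu> (\<lambda>x. h x * g x)" and bound: "\<bar>LINT x | \<mu>. h x * g x\<bar> \<le> B * norm_L1 \<mu> h"
    if h: "integrable \<mu> h" for h
  proof -
    have le: "\<bar>h x * g x\<bar> \<le> B * \<bar>h x\<bar>" if "x \<in> space \<mu>" for x
      using mult_right_mono[OF B[OF that], of "\<bar>h x\<bar>"] by (simp add: abs_mult mult.commute)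
    show int: "integrable \<mu> (\<lambda>x. h x * g x)"
      by (rule Bochner_Integration.integrable_bound[of \<mu> "\<lambda>x. B * \<bar>h x\<bar>"])
        (use h g le in \<open>auto intro!: AE_I2 intro: order_trans[OF _ abs_ge_self]\<close>)
    have "\<bar>LINT x | \<mu>. h x * g x\<bar> \<le> (LINT x | \<mu>. \<bar>h x * g x\<bar>)"
      by (rule integral_abs_bound)
    also have "\<dots> \<le> (LINT x | \<mu>. B * \<bar>h x\<bar>)"
      using int h le by (intro integral_mono) auto
    finally show "\<bar>LINT x | \<mu>. h x * g x\<bar> \<le> B * norm_L1 \<mu> h"
      by (simp add: norm_L1_def)
  qed
  have "(LINT x | \<mu>. w x * g x) = (LINT x | \<mu>. (w x - f x) * g x) + (LINT x | \<mu>. f x * g x)"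
    using int[OF w] int[OF subspace_integrable[OF f]] by (simp add: left_diff_distrib)
  then show ?thesis
    using bound[OF Bochner_Integration.integrable_diff[OF w subspace_integrable[OF f]]]
      abs_integral_le_dual_norm[OF f bounded_measurableI[OF g B]] by linarith
qed

end

section \<open>Change of measure and the uniform size of the errors\<close>

lemma
  assumes \<mu>: "\<mu> \<in> space (prob_algebra S)" and P: "P \<in> space (prob_algebra S)"
    and ac: "absolutely_continuous \<mu> P"
  shows integrable_density_ratio: "integrable \<mu> (density_ratio \<mu> P)"
    and integral_density_ratio:
      "g \<in> borel_measurable S \<Longrightarrow> (LINT x | P. g x) = (LINT x | \<mu>. density_ratio \<mu> P x * g x)"
proof -
  interpret \<mu>: prob_space \<mu> by (rule space_prob_algebraD[OF \<mu>])
  interpret P: prob_space P by (rule space_prob_algebraD[OF P])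
  have sets: "sets P = sets \<mu>" using space_prob_algebraD(2)[OF \<mu>] space_prob_algebraD(2)[OF P] by simp
  show "(LINT x | P. g x) = (LINT x | \<mu>. density_ratio \<mu> P x * g x)" if "g \<in> borel_measurable S"
  proof -
    have "g \<in> borel_measurable \<mu>"
      using that space_prob_algebraD(2)[OF \<mu>] by (simp cong: measurable_cong_sets)
    then show ?thesis
      unfolding density_ratio_def by (rule \<mu>.RN_deriv_integral[OF P.sigma_finite_measure_axioms ac sets])
  qed
  \<comment> \<open>The constant 1 is integrable for \<open>P\<close>; transported to
    \<open>\<mu>\<close> it becomes the density itself.\<close>
  show "integrable \<mu> (density_ratio \<mu> P)"
    using \<mu>.RN_deriv_integrable[OF P.sigma_finite_measure_axioms ac sets, of "\<lambda>_. 1"]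
    by (simp add: density_ratio_def[abs_def])
qed

text \<open>The contributions are \<open>c\<close> from \<open>X f\<close>, 1 from the mean reward
  and \<open>c\<close> from the discounted transfer term. The bound involves neither
  \<open>X\<close> nor \<open>f\<close>, so one link function built from it can serve all
  operators.\<close>

lemma (in mdp_policy) \<Delta>op_bound:
  assumes X: "X \<in> operators M c" and f: "f \<in> value_functions M c" and \<gamma>: "0 \<le> \<gamma>" "\<gamma> \<le> 1"
    and x: "x \<in> space SA"
  shows "\<bar>\<Delta>op M \<pi> \<gamma> X f x\<bar> \<le> 1 + 2 * c"
proof -
  have f': "f \<in> borel_measurable SA" "\<And>y. y \<in> space SA \<Longrightarrow> \<bar>f y\<bar> \<le> c"
    using f unfolding value_functions_def by auto
  have "\<bar>mean_reward x\<bar> \<le> 1"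
    unfolding mean_reward_def
    by (rule abs_integral_le_bound[OF measurable_space[OF reward x]])
      (auto simp: space_restrict_space intro: measurable_restrict_space1)
  moreover have t: "\<bar>transfer f x\<bar> \<le> c"
    unfolding transfer_def by (rule abs_integral_le_bound[OF measurable_space[OF sa_kernel x] f'(2,1)])
  moreover have "\<bar>\<gamma> * transfer f x\<bar> \<le> 1 * c"
    unfolding abs_mult using \<gamma> t by (intro mult_mono) auto
  moreover have "X f \<in> value_functions M c"
    using X f unfolding operators_def by blast
  then have "\<bar>X f x\<bar> \<le> c"
    using x unfolding value_functions_def by simp
  ultimately show ?thesis
    unfolding \<Delta>op_def bellman_eq[OF x value_functions_bounded[OF f]] by linarith
qed

section \<open>The K-functional of the density ratios and the two estimates\<close>

theorem proposition1:
  fixes M :: "('s, 'a) mdp" and \<pi> :: "'s \<Rightarrow> 'a measure" and H :: nat and \<gamma> :: real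
    and \<mu> :: "('s \<times> 'a) measure"
    and F :: "('s \<times> 'a \<Rightarrow> real) set" and N :: "('s \<times> 'a \<Rightarrow> real) \<Rightarrow> real"
  assumes "is_mdp M" and "is_policy M \<pi>"
    and "1 \<le> H" and "0 \<le> \<gamma>" and "\<gamma> \<le> 1"
    and "\<mu> \<in> space (prob_algebra (sa_space M))"
    and "measure_support (sa_topology M) \<mu> = space (sa_space M)"
    and "\<forall>h \<in> {1..H}. absolutely_continuous \<mu> (sa_dist M \<pi> h)"
    and "banach_subspace_L1 \<mu> F N" and "dense_in_L1 \<mu> F"
  shows "\<exists>\<phi>. link_function \<phi> \<and>
    (\<forall>y\<ge>0. ereal (\<phi> y) \<le>
       ereal (horizon_const H \<gamma>) *
       (MAX h \<in> {1..H}. ext_norm F N (density_ratio \<mu> (sa_dist M \<pi> h))) * ereal y) \<and>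
    (\<forall>X \<in> operators M (horizon_const H \<gamma>).
       \<bar>\<Delta>J M \<pi> H \<gamma> (Q_iter X H)\<bar> \<le>
       \<phi> (1 / horizon_const H \<gamma> *
          (\<Sum>h = 1..H. \<gamma> ^ (H - h) *
             dual_norm \<mu> F N (\<Delta>op M \<pi> \<gamma> X (Q_iter X (h - 1))))))"
proof -
  interpret mdp_policy M \<pi> using assms(1,2) by unfold_locales
  note H = \<open>1 \<le> H\<close> and \<gamma> = \<open>0 \<le> \<gamma>\<close> \<open>\<gamma> \<le> 1\<close>
  note \<mu> = \<open>\<mu> \<in> space (prob_algebra SA)\<close> and F = \<open>banach_subspace_L1 \<mu> F N\<close>
  define C where "C = horizon_const H \<gamma>"
  define B where "B = 1 + 2 * C"
  define w where "w k = density_ratio \<mu> (sa_dist M \<pi> k)" for k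
  define S where "S = {(B * (\<Sum>k = 1..H. norm_L1 \<mu> (\<lambda>x. w k x - f k x)), C * m) | f m.
    \<forall>k \<in> {1..H}. f k \<in> F \<and> N (f k) \<le> m}"
  define \<phi> where "\<phi> y = (INF p \<in> S. fst p + snd p * y)" for y
  \<comment> \<open>The summand for \<open>h = 1\<close> is \<open>\<gamma> ^ 0 = 1\<close>, also
    when \<open>\<gamma> = 0\<close>.\<close>
  have C: "1 \<le> C"
    using member_le_sum[of 1 "{1..H}" "\<lambda>h. \<gamma> ^ (h - 1)"] H \<gamma> by (simp add: C_def horizon_const_def)
  have B: "0 < B" using C by (simp add: B_def)
  have ac: "absolutely_continuous \<mu> (sa_dist M \<pi> k)" if "k \<in> {1..H}" for k
    using assms(8) that by blast
  have P: "sa_dist M \<pi> k \<in> space (prob_algebra SA)" if "k \<in> {1..H}" for k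
    using sa_dist_in that by simp
  have w: "integrable \<mu> (w k)" if "k \<in> {1..H}" for k
    unfolding w_def by (rule integrable_density_ratio[OF \<mu> P[OF that] ac[OF that]])
  have L1: "0 \<le> norm_L1 \<mu> g" for g :: "'s \<times> 'a \<Rightarrow> real"
    unfolding norm_L1_def by simp
  have pos: "0 \<le> fst p \<and> 0 \<le> snd p" if p: "p \<in> S" for p
  proof -
    obtain f m where p: "p = (B * (\<Sum>k = 1..H. norm_L1 \<mu> (\<lambda>x. w k x - f k x)), C * m)"
      and f: "\<forall>k \<in> {1..H}. f k \<in> F \<and> N (f k) \<le> m"
      using p unfolding S_def by blast
    \<comment> \<open>Since \<open>1 \<le> H\<close>, the tuple has an entry whose norm forces
      \<open>m\<close> to be nonnegative.\<close>
    have "f 1 \<in> F" "N (f 1) \<le> m" using f H by auto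
    then have "0 \<le> m" using subspace_norm_nonneg[OF F] by force
    then show ?thesis using B C L1 by (simp add: p sum_nonneg)
  qed
  have small: "\<exists>p \<in> S. fst p < e" if e: "0 < e" for e
  proof -
    \<comment> \<open>\<open>H\<close> errors below \<open>d\<close>, weighted by \<open>B\<close>,
      add up to at most \<open>e / 2\<close>.\<close>
    define d where "d = e / (2 * B * H)"
    have d: "0 < d" "B * (H * d) = e / 2" using e B H by (auto simp: d_def field_simps)
    have "\<forall>k \<in> {1..H}. \<exists>f \<in> F. norm_L1 \<mu> (\<lambda>x. w k x - f x) < d"
      using \<open>dense_in_L1 \<mu> F\<close> w d(1) unfolding dense_in_L1_def by blast
    then obtain f where f: "\<And>k. k \<in> {1..H} \<Longrightarrow> f k \<in> F"
      "\<And>k. k \<in> {1..H} \<Longrightarrow> norm_L1 \<mu> (\<lambda>x. w k x - f k x) < d"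
      by metis
    \<comment> \<open>The sum of the nonnegative norms serves as the common bound
      \<open>m\<close>.\<close>
    have "N (f k) \<le> (\<Sum>k = 1..H. N (f k))" if "k \<in> {1..H}" for k
      using that f(1) subspace_norm_nonneg[OF F] by (intro member_le_sum) auto
    then have "(B * (\<Sum>k = 1..H. norm_L1 \<mu> (\<lambda>x. w k x - f k x)), C * (\<Sum>k = 1..H. N (f k))) \<in> S"
      using f(1) unfolding S_def by blast
    moreover have "(\<Sum>k = 1..H. norm_L1 \<mu> (\<lambda>x. w k x - f k x)) \<le> H * d"
      using sum_bounded_above[of "{1..H}" "\<lambda>k. norm_L1 \<mu> (\<lambda>x. w k x - f k x)" d] f(2) by (simp add: less_imp_le)
    then have "B * (\<Sum>k = 1..H. norm_L1 \<mu> (\<lambda>x. w k x - f k x)) \<le> B * (H * d)"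
      using B by (intro mult_left_mono) auto
    then have "B * (\<Sum>k = 1..H. norm_L1 \<mu> (\<lambda>x. w k x - f k x)) < e" using d e by simp
    ultimately show ?thesis by (metis fst_conv)
  qed
  have link: "link_function \<phi>"
    using link_function_INF_affine[OF pos small] by (simp add: \<phi>_def[abs_def])
  have upper: "ereal (\<phi> y) \<le> ereal C * (MAX h \<in> {1..H}. ext_norm F N (w h)) * ereal y" if y: "0 \<le> y" for y
  proof -
    define E where "E = (MAX h \<in> {1..H}. ext_norm F N (w h))"
    have E: "ext_norm F N (w k) \<le> E" if "k \<in> {1..H}" for k
      unfolding E_def using that by (intro Max_ge) auto
    show ?thesis
    proof (cases "E = \<infinity>")
      case True
      show ?thesis
      \<comment> \<open>At \<open>y = 0\<close> the right side is 0, as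
        \<open>\<infinity> * 0 = 0\<close> in \<open>ereal\<close>, and the claim rests on
        \<open>\<phi> 0 = 0\<close>. For \<open>y > 0\<close> the product is infinite because
        \<open>C\<close> is positive.\<close>
      proof (cases "y = 0")
        case True
        then show ?thesis using link by (simp add: link_function_def flip: zero_ereal_def)
      next
        case False
        then show ?thesis using True y C unfolding E_def[symmetric] by simp
      qed
    next
      case False
      have wF: "w k \<in> F" "ereal (N (w k)) \<le> E" if "k \<in> {1..H}" for k
        using E[OF that] False by (auto simp: ext_norm_def split: if_splits)
      have "E \<noteq> -\<infinity>" using wF(2)[of 1] H by auto
      then obtain m where m: "E = ereal m" using False by (cases E) auto
      \<comment> \<open>With a finite maximum \<open>m\<close> the density ratios themselves form an
        admissible tuple; its approximation error is 0, which leaves the purely linear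
        bound.\<close>
      have "(B * (\<Sum>k = 1..H. norm_L1 \<mu> (\<lambda>x. w k x - w k x)), C * m) \<in> S"
        unfolding S_def using wF m by (intro CollectI exI[of _ w] exI[of _ m]) auto
      then have "(0, C * m) \<in> S" by (simp add: norm_L1_def)
      then have "\<phi> y \<le> C * m * y"
        unfolding \<phi>_def using pos y
        by (intro cINF_lower2[where x = "(0, C * m)"] bdd_belowI2[where m = 0]) auto
      then show ?thesis unfolding E_def[symmetric] m by simp
    qed
  qed
  have error: "\<bar>\<Delta>J M \<pi> H \<gamma> (Q_iter X H)\<bar> \<le> \<phi> (1 / C * (\<Sum>h = 1..H. \<gamma> ^ (H - h) *
      dual_norm \<mu> F N (\<Delta>op M \<pi> \<gamma> X (Q_iter X (h - 1)))))"
    if X: "X \<in> operators M C" for X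
  proof -
    define g where "g h = \<Delta>op M \<pi> \<gamma> X (Q_iter X (h - 1))" for h
    define D where "D h = dual_norm \<mu> F N (g h)" for h
    have C0: "0 \<le> C" using C by simp
    note spaces = space_prob_algebraD(2,3)[OF \<mu>]
    have g: "g h \<in> borel_measurable SA" "\<And>x. x \<in> space SA \<Longrightarrow> \<bar>g h x\<bar> \<le> B" for h
      unfolding g_def B_def
      using \<Delta>op_bounded_measurable[OF X Q_iter_in[OF X C0], THEN bounded_measurableD]
        \<Delta>op_bound[OF X Q_iter_in[OF X C0] \<gamma>] by auto
    have g': "g h \<in> borel_measurable \<mu>" "\<And>x. x \<in> space \<mu> \<Longrightarrow> \<bar>g h x\<bar> \<le> B" for h
      using g spaces by (auto cong: measurable_cong_sets)
    have D: "0 \<le> D h" for h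
      unfolding D_def by (rule dual_norm_nonneg[OF F bounded_measurableI[OF g']])
    \<comment> \<open>It suffices to bound the error by every affine function of the family; the
      infimum inherits the bound.\<close>
    have "\<bar>\<Delta>J M \<pi> H \<gamma> (Q_iter X H)\<bar> \<le> fst p + snd p * (1 / C * (\<Sum>h = 1..H. \<gamma> ^ (H - h) * D h))"
      if p: "p \<in> S" for p
    proof -
      obtain f m where p: "p = (B * (\<Sum>k = 1..H. norm_L1 \<mu> (\<lambda>x. w k x - f k x)), C * m)"
        and f: "\<And>k. k \<in> {1..H} \<Longrightarrow> f k \<in> F" "\<And>k. k \<in> {1..H} \<Longrightarrow> N (f k) \<le> m"
        using p unfolding S_def by blast
      define n where "n k = norm_L1 \<mu> (\<lambda>x. w k x - f k x)" for k
      have summand: "\<bar>\<gamma> ^ (H - h) * (LINT x | sa_dist M \<pi> (Suc (H - h)). g h x)\<bar> \<le>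
          B * n (Suc (H - h)) + m * (\<gamma> ^ (H - h) * D h)" if h: "h \<in> {1..H}" for h
      proof -
        let ?k = "Suc (H - h)"
        have k: "?k \<in> {1..H}" using h by auto
        have "\<bar>LINT x | sa_dist M \<pi> ?k. g h x\<bar> = \<bar>LINT x | \<mu>. w ?k x * g h x\<bar>"
          unfolding w_def by (subst integral_density_ratio[OF \<mu> P[OF k] ac[OF k] g(1)]) simp
        also have "\<dots> \<le> B * n ?k + N (f ?k) * D h"
          unfolding n_def D_def by (rule abs_integral_le_approximation[OF F w[OF k] f(1)[OF k] g'])
        also have "\<dots> \<le> B * n ?k + m * D h"
          using f(2)[OF k] D by (intro add_left_mono mult_right_mono)
        finally have "\<gamma> ^ (H - h) * \<bar>LINT x | sa_dist M \<pi> ?k. g h x\<bar> \<le> \<gamma> ^ (H - h) * (B * n ?k + m * D h)"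
          using \<gamma> by (intro mult_left_mono) auto
        \<comment> \<open>The discount is at most 1 and is dropped from the \<open>L1\<close> term
          only; the dual-norm term keeps it to match the argument of \<open>\<phi>\<close>.\<close>
        also have "\<dots> \<le> B * n ?k + m * (\<gamma> ^ (H - h) * D h)"
          using mult_right_mono[OF power_le_one[OF \<gamma>, of "H - h"], of "B * n ?k"] B L1
          by (simp add: n_def algebra_simps)
        finally show ?thesis using \<gamma> by (simp add: abs_mult)
      qed
      have "\<bar>\<Delta>J M \<pi> H \<gamma> (Q_iter X H)\<bar> \<le> (\<Sum>h = 1..H. B * n (Suc (H - h)) + m * (\<gamma> ^ (H - h) * D h))"
        unfolding \<Delta>J_decomposition[OF X C0] g_def[symmetric]
        by (rule order_trans[OF sum_abs sum_mono]) (rule summand)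
      also have "\<dots> = B * (\<Sum>h = 1..H. n (Suc (H - h))) + m * (\<Sum>h = 1..H. \<gamma> ^ (H - h) * D h)"
        by (simp add: sum.distrib sum_distrib_left)
      \<comment> \<open>Time reversal: \<open>Suc (H - h)\<close> runs through each of the times
        \<open>1\<close> to \<open>H\<close> once.\<close>
      also have "(\<Sum>h = 1..H. n (Suc (H - h))) = (\<Sum>k = 1..H. n k)"
        by (subst (2) sum.atLeastAtMost_rev) (auto intro!: sum.cong simp: Suc_diff_le)
      finally show ?thesis using C by (simp add: p n_def)
    qed
    then show ?thesis
      unfolding \<phi>_def D_def[symmetric] g_def[symmetric] using small[of 1] by (intro cINF_greatest) auto
  qed
  show ?thesis
    using link upper error unfolding C_def w_def by blast
qed

end
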